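(* Let $\mathcal{H}=(\mathbb{A},\mathsf{St},\{\mathsf{Act}_a\},\{\mathsf{act}_a\},\mathsf{out},H)$ be a concurrent game Hintikka structure for an $\mathrm{ATL}^{+}$ state formula $\eta$, and let $\mathcal{M}$ be the concurrent game model with the same agents, states, actions and transitions and with labelling $L(s)=H(s)\cap\mathrm{Prop}$ for every $s\in\mathsf{St}$. Then for every $s\in\mathsf{St}$ and every $\mathrm{ATL}^{+}$ state formula $\varphi$, $\varphi\in H(s)$ implies $\mathcal{M},s\models\varphi$. In particular, $\mathcal{M}$ satisfies $\eta$.
   Context: $\mathrm{ATL}^{+}$ over agents $\mathbb{A}$ and atoms $\mathrm{Prop}$, in negation normal form: state formulae $\varphi::=l\mid\varphi\vee\varphi\mid\varphi\wedge\varphi\mid\langle\langle A\rangle\rangle\Phi\mid[[A]]\Phi$ ($l$ a literal), path formulae $\Phi::=\varphi\mid\bigcirc\varphi\mid\Box\varphi\mid\varphi\,\mathcal{U}\,\varphi\mid\Phi\vee\Phi\mid\Phi\wedge\Phi$; $\top:=p\vee\neg p$. Semantics over concurrent game models (deterministic transitions $\mathsf{out}(s,\sigma)$ for action profiles $\sigma$) with perfect-recall strategies: $\langle\langle A\rangle\rangle\Phi$ holds at $s$ iff some strategy of $A$ (map from histories to available $A$-actions) forces $\Phi$ on all consistent plays from $s$; $[[A]]\Phi$ iff some $A$-co-strategy (map giving, for each history and strategy of $A$, an available action tuple of $\mathbb{A}\setminus A$) forces $\Phi$ on all plays consistent with it. For an $A$-action $\sigma_A$ at $s$, $\mathsf{Out}(s,\sigma_A)$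 is the set of $\mathsf{out}(s,\sigma)$ for profiles $\sigma$ extending $\sigma_A$; an $A$-co-action $\sigma^c_A$ at $s$ maps each $A$-action to an action tuple of $\mathbb{A}\setminus A$, and $\mathsf{Out}(s,\sigma^c_A)$ is the set of outcomes of profiles combining some $\sigma_A$ with $\sigma^c_A(\sigma_A)$. Components: $\varphi\wedge\psi$ is an $\alpha$-formula with components $\varphi,\psi$ (and $[[\mathbb{A}]]\bigcirc\psi$ one with component $\langle\langle\emptyset\rangle\rangle\bigcirc\psi$); $\varphi\vee\psi$ is a $\beta$-formula with components $\varphi,\psi$. Decomposition: $\mathsf{dec}(\varphi)=\{\langle\varphi,\top\rangle\}$ for state formulae; $\mathsf{dec}(\bigcirc\varphi)=\{\langle\top,\varphi\rangle\}$; $\mathsf{dec}(\Box\varphi)=\{\langle\varphi,\Box\varphi\rangle\}$; $\mathsf{dec}(\varphi\,\mathcal{U}\,\psi)=\{\langle\varphi,\varphi\,\mathcal{U}\,\psi\rangle,\langle\psi,\top\rangle\}$; $\mathsf{dec}(\Phi_1\wedge\Phi_2)=\{\langle\psi_i\wedge\psi_j,\Psi_i\wedge\Psi_j\rangle\}$ over $\mathsf{dec}(\Phi_1)\times\mathsf{dec}(\Phi_2)$; $\mathsf{dec}(\Phi_1\vee\Phi_2)=\mathsf{dec}(\Phi_1)\cup\mathsf{dec}(\Phi_2)\cup\{\langle\psi_i\wedge\psi_j,\Psi_i\vee\Psi_j\rangle:\Psi_i\neq\top\neq\Psi_j\}$. A $\gamma$-formula (potential eventuality) is $\langle\langle A\rangle\rangle\Phi$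 or $[[A]]\Phi$ with main operator of $\Phi$ not $\bigcirc$; its $\gamma$-components are, for $\langle\psi,\Psi\rangle\in\mathsf{dec}(\Phi)$, $\psi$ if $\Psi=\top$ and otherwise $\psi\wedge\langle\langle A\rangle\rangle\bigcirc\langle\langle A\rangle\rangle\Psi$ (resp. $\psi\wedge[[A]]\bigcirc[[A]]\Psi$), in which case $\langle\langle A\rangle\rangle\Psi$ (resp. $[[A]]\Psi$) is a successor potential eventuality of it. $Real(\Phi,\Theta)$: conjunction/disjunction commute with $Real$; $Real(\varphi,\Theta)$ iff $\varphi\in\Theta$ (state formula); $Real(\bigcirc\varphi,\Theta)$ false; $Real(\Box\varphi,\Theta)$ iff $\varphi\in\Theta$; $Real(\varphi\,\mathcal{U}\,\psi,\Theta)$ iff $\psi\in\Theta$. A realization witness tree for $\xi=\langle\langle A\rangle\rangle\Phi\in H(s)$ at $s$ is a finite tree whose nodes $w$ are coloured by states $c(w)$ and carry potential eventualities $\xi_w=\langle\langle A\rangle\rangle\Phi_w\in H(c(w))$, with root coloured $s$ and carrying $\xi$, such that: at each interior node $w$ there is a successor potential eventuality $\xi'$ of $\xi_w$ with $\langle\langle A\rangle\rangle\bigcirc\xi'\in H(c(w))$ and an $A$-action $\sigma_A$ at $c(w)$ enforcing $\xi'$ (i.e. $\xi'\in H(t)$ for all $t\in\mathsf{Out}(c(w),\sigma_A)$), the children of $w$ being coloured bijectively by $\mathsf{Out}(c(w),\sigma_A)$ and carrying $\xi'$; at each leaf $w$, $Real(\Phi_w,H(c(w)))$ holds. For $\xi=[[A]]\Phi$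 the definition is the same with $[[A]]$ in place of $\langle\langle A\rangle\rangle$ and an $A$-co-action $\sigma^c_A$ in place of $\sigma_A$. A concurrent game Hintikka structure is a concurrent game structure with deterministic transitions whose states are labelled by sets $H(s)$ of $\mathrm{ATL}^{+}$ formulae such that for all $s$: (H1) $\varphi\in H(s)$ implies $\neg\varphi\notin H(s)$; (H2) if an $\alpha$-formula is in $H(s)$, both its $\alpha$-components are; (H3) if a $\beta$-formula is in $H(s)$, one of its $\beta$-components is; (H4) if a $\gamma$-formula is in $H(s)$, one of its $\gamma$-components is; (H5) if $\langle\langle A\rangle\rangle\bigcirc\psi\in H(s)$ there is an $A$-action $\sigma_A$ at $s$ with $\psi\in H(s')$ for all $s'\in\mathsf{Out}(s,\sigma_A)$, and if $[[A]]\bigcirc\psi\in H(s)$ there is an $A$-co-action $\sigma^c_A$ at $s$ with $\psi\in H(s')$ for all $s'\in\mathsf{Out}(s,\sigma^c_A)$; (H6) for every potential eventuality $\xi\in H(s)$ there is a realization witness tree for $\xi$ at $s$. It is a Hintikka structure for $\eta$ if $\eta\in H(s)$ for some state $s$.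
   Formalization: At an interior node of a realization witness tree, the successor potential eventuality must come from a pair ⟨ψ,Ψ⟩ in dec(Φ_w) with ψ also in H(c(w)); without this the statement fails, e.g. for Φ = x U b ∧ □x at a one-state loop labelled with x but not b. *)

theory Defs
  imports "HOL-Library.FuncSet"
begin

text \<open>
  The agents, the atoms and the states are the types \<open>'ag\<close>, \<open>'p\<close> and \<open>'s\<close>; a coalition is a set
  of agents. \<open>Strat A \<Phi>\<close> and \<open>CoStrat A \<Phi>\<close> stand for \<open>\<langle>\<langle>A\<rangle>\<rangle>\<Phi>\<close> and \<open>[[A]]\<Phi>\<close>, and \<open>PState\<close> is
  the inclusion of state formulae into path formulae.
\<close>

datatype ('ag, 'p) sfm =
    Atom 'p
  | NegAtom 'p
  | Or "('ag, 'p) sfm" "('ag, 'p) sfm"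
  | And "('ag, 'p) sfm" "('ag, 'p) sfm"
  | Strat "'ag set" "('ag, 'p) pfm"
  | CoStrat "'ag set" "('ag, 'p) pfm"
and ('ag, 'p) pfm =
    PState "('ag, 'p) sfm"
  | PNext "('ag, 'p) sfm"
  | PBox "('ag, 'p) sfm"
  | PUntil "('ag, 'p) sfm" "('ag, 'p) sfm"
  | POr "('ag, 'p) pfm" "('ag, 'p) pfm"
  | PAnd "('ag, 'p) pfm" "('ag, 'p) pfm"

text \<open>The atom in \<open>\<top> = p \<or> \<not>p\<close> is an arbitrary but fixed one.\<close>

definition top_atom :: 'p where
  "top_atom = (SOME p. True)"

definition Top :: "('ag, 'p) sfm" where
  "Top = Or (Atom top_atom) (NegAtom top_atom)"


section \<open>Concurrent game structures and models\<close>

record ('ag, 's, 'act) cgs =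
  Act :: "'ag \<Rightarrow> 'act set"
  act :: "'ag \<Rightarrow> 's \<Rightarrow> 'act set"
  out :: "'s \<Rightarrow> ('ag \<Rightarrow> 'act) \<Rightarrow> 's"

record ('ag, 's, 'act, 'p) cgm = "('ag, 's, 'act) cgs" +
  Lab :: "'s \<Rightarrow> 'p set"

record ('ag, 's, 'act, 'p) cghs = "('ag, 's, 'act) cgs" +
  Hint :: "'s \<Rightarrow> ('ag, 'p) sfm set"

definition cgs :: "('ag, 's, 'act, 'z) cgs_scheme \<Rightarrow> bool" where
  "cgs S \<longleftrightarrow> (\<forall>a s. act S a s \<noteq> {} \<and> act S a s \<subseteq> Act S a)"

text \<open>\<open>out S s \<sigma>\<close> is only ever used for \<open>\<sigma> \<in> actions S UNIV s\<close>, the action profiles at \<open>s\<close>.\<close>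

definition actions :: "('ag, 's, 'act, 'z) cgs_scheme \<Rightarrow> 'ag set \<Rightarrow> 's \<Rightarrow> ('ag \<Rightarrow> 'act) set" where
  "actions S A s = (\<Pi>\<^sub>E a\<in>A. act S a s)"

definition co_actions ::
    "('ag, 's, 'act, 'z) cgs_scheme \<Rightarrow> 'ag set \<Rightarrow> 's \<Rightarrow> (('ag \<Rightarrow> 'act) \<Rightarrow> ('ag \<Rightarrow> 'act)) set" where
  "co_actions S A s = (\<Pi>\<^sub>E \<sigma>\<in>actions S A s. actions S (- A) s)"

definition combine :: "'ag set \<Rightarrow> ('ag \<Rightarrow> 'act) \<Rightarrow> ('ag \<Rightarrow> 'act) \<Rightarrow> ('ag \<Rightarrow> 'act)" where
  "combine A \<sigma> \<tau> = (\<lambda>a. if a \<in> A then \<sigma> a else \<tau> a)"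

definition Out :: "('ag, 's, 'act, 'z) cgs_scheme \<Rightarrow> 'ag set \<Rightarrow> 's \<Rightarrow> ('ag \<Rightarrow> 'act) \<Rightarrow> 's set" where
  "Out S A s \<sigma>A = {out S s \<sigma> | \<sigma>. \<sigma> \<in> actions S UNIV s \<and> (\<forall>a\<in>A. \<sigma> a = \<sigma>A a)}"

definition co_Out ::
    "('ag, 's, 'act, 'z) cgs_scheme \<Rightarrow> 'ag set \<Rightarrow> 's \<Rightarrow> (('ag \<Rightarrow> 'act) \<Rightarrow> ('ag \<Rightarrow> 'act)) \<Rightarrow> 's set" where
  "co_Out S A s \<sigma>c = {out S s (combine A \<sigma>A (\<sigma>c \<sigma>A)) | \<sigma>A. \<sigma>A \<in> actions S A s}"

definition play :: "('ag, 's, 'act, 'z) cgs_scheme \<Rightarrow> (nat \<Rightarrow> 's) \<Rightarrow> bool" where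
  "play S \<pi> \<longleftrightarrow> (\<forall>i. \<exists>\<sigma>\<in>actions S UNIV (\<pi> i). \<pi> (Suc i) = out S (\<pi> i) \<sigma>)"

definition prefix :: "(nat \<Rightarrow> 's) \<Rightarrow> nat \<Rightarrow> 's list" where
  "prefix \<pi> i = map \<pi> [0..<Suc i]"

definition history :: "('ag, 's, 'act, 'z) cgs_scheme \<Rightarrow> 's list \<Rightarrow> bool" where
  "history S h \<longleftrightarrow> (\<exists>\<pi> i. play S \<pi> \<and> h = prefix \<pi> i)"

definition strategy ::
    "('ag, 's, 'act, 'z) cgs_scheme \<Rightarrow> 'ag set \<Rightarrow> ('s list \<Rightarrow> 'ag \<Rightarrow> 'act) \<Rightarrow> bool" where
  "strategy S A F \<longleftrightarrow> (\<forall>h. history S h \<longrightarrow> F h \<in> actions S A (last h))"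

definition consistent ::
    "('ag, 's, 'act, 'z) cgs_scheme \<Rightarrow> 'ag set \<Rightarrow> 's \<Rightarrow> ('s list \<Rightarrow> 'ag \<Rightarrow> 'act) \<Rightarrow> (nat \<Rightarrow> 's) \<Rightarrow> bool" where
  "consistent S A s F \<pi> \<longleftrightarrow> \<pi> 0 = s \<and> (\<forall>i. \<pi> (Suc i) \<in> Out S A (\<pi> i) (F (prefix \<pi> i)))"

definition co_strategy ::
    "('ag, 's, 'act, 'z) cgs_scheme \<Rightarrow> 'ag set \<Rightarrow>
     ('s list \<Rightarrow> ('s list \<Rightarrow> 'ag \<Rightarrow> 'act) \<Rightarrow> 'ag \<Rightarrow> 'act) \<Rightarrow> bool" where
  "co_strategy S A G \<longleftrightarrow>
     (\<forall>h F. history S h \<and> strategy S A F \<longrightarrow> G h F \<in> actions S (- A) (last h))"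

definition co_consistent ::
    "('ag, 's, 'act, 'z) cgs_scheme \<Rightarrow> 'ag set \<Rightarrow> 's \<Rightarrow>
     ('s list \<Rightarrow> ('s list \<Rightarrow> 'ag \<Rightarrow> 'act) \<Rightarrow> 'ag \<Rightarrow> 'act) \<Rightarrow> (nat \<Rightarrow> 's) \<Rightarrow> bool" where
  "co_consistent S A s G \<pi> \<longleftrightarrow> \<pi> 0 = s \<and>
     (\<exists>F. strategy S A F \<and>
       (\<forall>i. \<pi> (Suc i) = out S (\<pi> i) (combine A (F (prefix \<pi> i)) (G (prefix \<pi> i) F))))"

primrec sat :: "('ag, 's, 'act, 'p) cgm \<Rightarrow> 's \<Rightarrow> ('ag, 'p) sfm \<Rightarrow> bool"
  and psat :: "('ag, 's, 'act, 'p) cgm \<Rightarrow> (nat \<Rightarrow> 's) \<Rightarrow> ('ag, 'p) pfm \<Rightarrow> bool" where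
  "sat M s (Atom p) \<longleftrightarrow> p \<in> Lab M s"
| "sat M s (NegAtom p) \<longleftrightarrow> p \<notin> Lab M s"
| "sat M s (Or \<phi> \<psi>) \<longleftrightarrow> sat M s \<phi> \<or> sat M s \<psi>"
| "sat M s (And \<phi> \<psi>) \<longleftrightarrow> sat M s \<phi> \<and> sat M s \<psi>"
| "sat M s (Strat A \<Phi>) \<longleftrightarrow>
     (\<exists>F. strategy M A F \<and> (\<forall>\<pi>. consistent M A s F \<pi> \<longrightarrow> psat M \<pi> \<Phi>))"
| "sat M s (CoStrat A \<Phi>) \<longleftrightarrow>
     (\<exists>G. co_strategy M A G \<and> (\<forall>\<pi>. co_consistent M A s G \<pi> \<longrightarrow> psat M \<pi> \<Phi>))"
| "psat M \<pi> (PState \<phi>) \<longleftrightarrow> sat M (\<pi> 0) \<phi>"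
| "psat M \<pi> (PNext \<phi>) \<longleftrightarrow> sat M (\<pi> 1) \<phi>"
| "psat M \<pi> (PBox \<phi>) \<longleftrightarrow> (\<forall>i. sat M (\<pi> i) \<phi>)"
| "psat M \<pi> (PUntil \<phi> \<psi>) \<longleftrightarrow> (\<exists>i. sat M (\<pi> i) \<psi> \<and> (\<forall>j<i. sat M (\<pi> j) \<phi>))"
| "psat M \<pi> (POr \<Phi> \<Psi>) \<longleftrightarrow> psat M \<pi> \<Phi> \<or> psat M \<pi> \<Psi>"
| "psat M \<pi> (PAnd \<Phi> \<Psi>) \<longleftrightarrow> psat M \<pi> \<Phi> \<and> psat M \<pi> \<Psi>"


section \<open>Components, decomposition and realization\<close>

fun dec :: "('ag, 'p) pfm \<Rightarrow> (('ag, 'p) sfm \<times> ('ag, 'p) pfm) set" where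
  "dec (PState \<phi>) = {(\<phi>, PState Top)}"
| "dec (PNext \<phi>) = {(Top, PState \<phi>)}"
| "dec (PBox \<phi>) = {(\<phi>, PBox \<phi>)}"
| "dec (PUntil \<phi> \<psi>) = {(\<phi>, PUntil \<phi> \<psi>), (\<psi>, PState Top)}"
| "dec (PAnd \<Phi>1 \<Phi>2) =
     {(And \<psi>1 \<psi>2, PAnd \<Psi>1 \<Psi>2) | \<psi>1 \<psi>2 \<Psi>1 \<Psi>2. (\<psi>1, \<Psi>1) \<in> dec \<Phi>1 \<and> (\<psi>2, \<Psi>2) \<in> dec \<Phi>2}"
| "dec (POr \<Phi>1 \<Phi>2) = dec \<Phi>1 \<union> dec \<Phi>2 \<union>
     {(And \<psi>1 \<psi>2, POr \<Psi>1 \<Psi>2) | \<psi>1 \<psi>2 \<Psi>1 \<Psi>2. (\<psi>1, \<Psi>1) \<in> dec \<Phi>1 \<and> (\<psi>2, \<Psi>2) \<in> dec \<Phi>2 \<and>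
        \<Psi>1 \<noteq> PState Top \<and> \<Psi>2 \<noteq> PState Top}"

fun alpha_components :: "('ag, 'p) sfm \<Rightarrow> ('ag, 'p) sfm set" where
  "alpha_components (And \<phi> \<psi>) = {\<phi>, \<psi>}"
| "alpha_components (CoStrat A (PNext \<psi>)) = (if A = UNIV then {Strat {} (PNext \<psi>)} else {})"
| "alpha_components _ = {}"

fun is_next :: "('ag, 'p) pfm \<Rightarrow> bool" where
  "is_next (PNext \<phi>) \<longleftrightarrow> True"
| "is_next _ \<longleftrightarrow> False"

fun potential_eventuality :: "('ag, 'p) sfm \<Rightarrow> bool" where
  "potential_eventuality (Strat A \<Phi>) \<longleftrightarrow> \<not> is_next \<Phi>"
| "potential_eventuality (CoStrat A \<Phi>) \<longleftrightarrow> \<not> is_next \<Phi>"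
| "potential_eventuality _ \<longleftrightarrow> False"

text \<open>Below, \<open>Q\<close> is one of the operators \<open>Strat A\<close> and \<open>CoStrat A\<close>.\<close>

definition gamma_component ::
    "(('ag, 'p) pfm \<Rightarrow> ('ag, 'p) sfm) \<Rightarrow> ('ag, 'p) sfm \<Rightarrow> ('ag, 'p) pfm \<Rightarrow> ('ag, 'p) sfm" where
  "gamma_component Q \<psi> \<Psi> = (if \<Psi> = PState Top then \<psi> else And \<psi> (Q (PNext (Q \<Psi>))))"

fun gamma_components :: "('ag, 'p) sfm \<Rightarrow> ('ag, 'p) sfm set" where
  "gamma_components (Strat A \<Phi>) = {gamma_component (Strat A) \<psi> \<Psi> | \<psi> \<Psi>. (\<psi>, \<Psi>) \<in> dec \<Phi>}"
| "gamma_components (CoStrat A \<Phi>) = {gamma_component (CoStrat A) \<psi> \<Psi> | \<psi> \<Psi>. (\<psi>, \<Psi>) \<in> dec \<Phi>}"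
| "gamma_components _ = {}"

fun Real :: "('ag, 'p) pfm \<Rightarrow> ('ag, 'p) sfm set \<Rightarrow> bool" where
  "Real (PState \<phi>) \<Theta> \<longleftrightarrow> \<phi> \<in> \<Theta>"
| "Real (PNext \<phi>) \<Theta> \<longleftrightarrow> False"
| "Real (PBox \<phi>) \<Theta> \<longleftrightarrow> \<phi> \<in> \<Theta>"
| "Real (PUntil \<phi> \<psi>) \<Theta> \<longleftrightarrow> \<psi> \<in> \<Theta>"
| "Real (PAnd \<Phi> \<Psi>) \<Theta> \<longleftrightarrow> Real \<Phi> \<Theta> \<and> Real \<Psi> \<Theta>"
| "Real (POr \<Phi> \<Psi>) \<Theta> \<longleftrightarrow> Real \<Phi> \<Theta> \<or> Real \<Psi> \<Theta>"


section \<open>Realization witness trees\<close>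

text \<open>
  A node carries its colour and the path formula \<open>\<Phi>\<^sub>w\<close> of its potential eventuality
  \<open>\<xi>\<^sub>w = Q \<Phi>\<^sub>w\<close>. The order of the children is irrelevant; leaves are the nodes without children.
\<close>

datatype ('ag, 's, 'p) wtree =
  WNode (colour: 's) (carried: "('ag, 'p) pfm") (children: "('ag, 's, 'p) wtree list")

text \<open>
  The parameter \<open>moves s\<close> is the family of all outcome sets \<open>Out(s, \<sigma>\<^sub>A)\<close> (resp. \<open>Out(s, \<sigma>\<^sup>c\<^sub>A)\<close>).

  The successor \<open>Q \<Psi>\<close> used at an interior node comes from a pair \<open>(\<psi>, \<Psi>) \<in> dec \<Phi>\<close> whose present
  part \<open>\<psi>\<close> is in the label too, i.e. from a \<open>\<gamma>\<close>-component \<open>\<psi> \<and> Q\<circle>Q\<Psi>\<close> that holds in the label.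
  Without \<open>\<psi> \<in> H c\<close> a tree could discharge an until that is never fulfilled: take one state with
  one transition and \<open>\<Phi> = x U b \<and> \<box>x\<close>, where the label contains \<open>x\<close> but not \<open>b\<close>; the pair
  \<open>(b \<and> x, \<top> \<and> \<box>x)\<close> yields the successor \<open>Q(\<top> \<and> \<box>x)\<close>, which is realized at once.
\<close>

fun witness_tree ::
    "(('ag, 'p) pfm \<Rightarrow> ('ag, 'p) sfm) \<Rightarrow> ('s \<Rightarrow> 's set set) \<Rightarrow> ('s \<Rightarrow> ('ag, 'p) sfm set) \<Rightarrow>
     ('ag, 's, 'p) wtree \<Rightarrow> bool" where
  "witness_tree Q moves H (WNode c \<Phi> ts) \<longleftrightarrow>
     potential_eventuality (Q \<Phi>) \<and> Q \<Phi> \<in> H c \<and>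
     (if ts = [] then Real \<Phi> (H c)
      else (\<exists>\<psi> \<Psi>. (\<psi>, \<Psi>) \<in> dec \<Phi> \<and> \<Psi> \<noteq> PState Top \<and>
              \<psi> \<in> H c \<and> Q (PNext (Q \<Psi>)) \<in> H c \<and>
              (\<exists>X\<in>moves c. (\<forall>t\<in>X. Q \<Psi> \<in> H t) \<and>
                 distinct (map colour ts) \<and> set (map colour ts) = X \<and>
                 (\<forall>t\<in>set ts. carried t = \<Psi>)))) \<and>
     (\<forall>t\<in>set ts. witness_tree Q moves H t)"

definition strat_moves :: "('ag, 's, 'act, 'z) cgs_scheme \<Rightarrow> 'ag set \<Rightarrow> 's \<Rightarrow> 's set set" where
  "strat_moves S A s = {Out S A s \<sigma>A | \<sigma>A. \<sigma>A \<in> actions S A s}"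

definition co_strat_moves :: "('ag, 's, 'act, 'z) cgs_scheme \<Rightarrow> 'ag set \<Rightarrow> 's \<Rightarrow> 's set set" where
  "co_strat_moves S A s = {co_Out S A s \<sigma>c | \<sigma>c. \<sigma>c \<in> co_actions S A s}"

fun has_witness_tree :: "('ag, 's, 'act, 'p) cghs \<Rightarrow> 's \<Rightarrow> ('ag, 'p) sfm \<Rightarrow> bool" where
  "has_witness_tree S s (Strat A \<Phi>) \<longleftrightarrow>
     (\<exists>T. witness_tree (Strat A) (strat_moves S A) (Hint S) T \<and> colour T = s \<and> carried T = \<Phi>)"
| "has_witness_tree S s (CoStrat A \<Phi>) \<longleftrightarrow>
     (\<exists>T. witness_tree (CoStrat A) (co_strat_moves S A) (Hint S) T \<and> colour T = s \<and> carried T = \<Phi>)"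
| "has_witness_tree S s _ \<longleftrightarrow> False"


section \<open>Hintikka structures\<close>

text \<open>
  In negation normal form, \<open>\<not>\<phi>\<close> is a formula only for atomic \<open>\<phi>\<close>, so (H1) is about atoms.
\<close>

definition hintikka_structure :: "('ag, 's, 'act, 'p) cghs \<Rightarrow> bool" where
  "hintikka_structure S \<longleftrightarrow> cgs S \<and> (\<forall>s.
     (\<forall>p. Atom p \<in> Hint S s \<longrightarrow> NegAtom p \<notin> Hint S s) \<and>
     (\<forall>\<phi>\<in>Hint S s. alpha_components \<phi> \<subseteq> Hint S s) \<and>
     (\<forall>\<phi> \<psi>. Or \<phi> \<psi> \<in> Hint S s \<longrightarrow> \<phi> \<in> Hint S s \<or> \<psi> \<in> Hint S s) \<and>
     (\<forall>\<xi>\<in>Hint S s. potential_eventuality \<xi> \<longrightarrow> gamma_components \<xi> \<inter> Hint S s \<noteq> {}) \<and>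
     (\<forall>A \<psi>. Strat A (PNext \<psi>) \<in> Hint S s \<longrightarrow>
        (\<exists>\<sigma>A\<in>actions S A s. \<forall>t\<in>Out S A s \<sigma>A. \<psi> \<in> Hint S t)) \<and>
     (\<forall>A \<psi>. CoStrat A (PNext \<psi>) \<in> Hint S s \<longrightarrow>
        (\<exists>\<sigma>c\<in>co_actions S A s. \<forall>t\<in>co_Out S A s \<sigma>c. \<psi> \<in> Hint S t)) \<and>
     (\<forall>\<xi>\<in>Hint S s. potential_eventuality \<xi> \<longrightarrow> has_witness_tree S s \<xi>))"

definition hintikka_structure_for :: "('ag, 's, 'act, 'p) cghs \<Rightarrow> ('ag, 'p) sfm \<Rightarrow> bool" where
  "hintikka_structure_for S \<eta> \<longleftrightarrow> hintikka_structure S \<and> (\<exists>s. \<eta> \<in> Hint S s)"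

definition model_of :: "('ag, 's, 'act, 'p) cghs \<Rightarrow> ('ag, 's, 'act, 'p) cgm" where
  "model_of S = \<lparr>Act = Act S, act = act S, out = out S, Lab = (\<lambda>s. {p. Atom p \<in> Hint S s})\<rparr>"

end

theory Submission
  imports Defs
begin

text \<open>
  The coalition plays a strategy whose memory is a witness tree rooted at the current state.
  At an interior node it plays the move of the tree and descends; at a leaf it moves according to
  (H4) and (H5) and picks a fresh witness tree at the state that is reached. Along a play this
  yields path formulae \<open>\<Phi>\<^sub>0, \<Phi>\<^sub>1, \<dots>\<close> in which \<open>\<Phi>\<^sub>i\<^sub>+\<^sub>1\<close> is the second component of a pair in
  \<open>dec \<Phi>\<^sub>i\<close> whose first component holds at the \<open>i\<close>-th state. If \<open>\<top>\<close> is ever reached, then \<open>\<Phi>\<^sub>0\<close>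
  holds by going back one step at a time. Otherwise the sequence is eventually constant, since a
  step either preserves or shrinks the formula. Witness trees are finite, so the constant value
  satisfies \<open>Real\<close> at some later position; together with the first components that hold forever
  this makes the constant formula true.
\<close>

section \<open>Decomposition of path formulae\<close>

text \<open>These are the state formulae whose truth the induction in \<open>truth_lemma\<close>
  supplies; the path operators above them are handled through \<open>dec\<close> and
  \<open>Real\<close>.\<close>

primrec state_parts :: "('ag, 'p) pfm \<Rightarrow> ('ag, 'p) sfm set" where
  "state_parts (PState \<phi>) = {\<phi>}"
| "state_parts (PNext \<phi>) = {\<phi>}"
| "state_parts (PBox \<phi>) = {\<phi>}"
| "state_parts (PUntil \<phi> \<psi>) = {\<phi>, \<psi>}"
| "state_parts (POr \<Phi> \<Psi>) = state_parts \<Phi> \<union> state_parts \<Psi>"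
| "state_parts (PAnd \<Phi> \<Psi>) = state_parts \<Phi> \<union> state_parts \<Psi>"

text \<open>The values make every pair of \<open>dec\<close> that changes a formula lower its
  weight: a next becomes a state formula (3 to at most 2), an until or a state formula other than
  \<open>Top\<close> drops to \<open>PState Top\<close> (2 to 1), and discarding a disjunct removes
  a positive summand.\<close>

primrec weight :: "('ag, 'p) pfm \<Rightarrow> nat" where
  "weight (PState \<phi>) = (if \<phi> = Top then 1 else 2)"
| "weight (PNext \<phi>) = 3"
| "weight (PBox \<phi>) = 1"
| "weight (PUntil \<phi> \<psi>) = 2"
| "weight (POr \<Phi> \<Psi>) = weight \<Phi> + weight \<Psi>"
| "weight (PAnd \<Phi> \<Psi>) = weight \<Phi> + weight \<Psi>"

text \<open>Mutual induction with a trivial predicate on state formulae, which thereby become opaque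
  leaves of path formulae.\<close>

lemma pfm_induct [case_names PState PNext PBox PUntil POr PAnd]:
  assumes "\<And>\<phi>. P (PState \<phi>)" "\<And>\<phi>. P (PNext \<phi>)" "\<And>\<phi>. P (PBox \<phi>)" "\<And>\<phi> \<psi>. P (PUntil \<phi> \<psi>)"
    and "\<And>\<Phi> \<Psi>. P \<Phi> \<Longrightarrow> P \<Psi> \<Longrightarrow> P (POr \<Phi> \<Psi>)" "\<And>\<Phi> \<Psi>. P \<Phi> \<Longrightarrow> P \<Psi> \<Longrightarrow> P (PAnd \<Phi> \<Psi>)"
  shows "P \<Phi>"
  by (rule pfm.induct[where ?P1.0 = "\<lambda>_. True"]) (simp_all add: assms)

lemma sat_Top [simp]: "sat M s Top"
  by (simp add: Top_def)

lemma weight_pos: "0 < weight \<Phi>"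
  by (induction \<Phi> rule: pfm_induct) auto

lemma dec_not_next: "(\<psi>, \<Psi>) \<in> dec \<Phi> \<Longrightarrow> \<not> is_next \<Psi>"
  by (induction \<Phi> arbitrary: \<psi> \<Psi> rule: pfm_induct) auto

lemma dec_state_parts: "(\<psi>, \<Psi>) \<in> dec \<Phi> \<Longrightarrow> state_parts \<Psi> \<subseteq> insert Top (state_parts \<Phi>)"
  by (induction \<Phi> arbitrary: \<psi> \<Psi> rule: pfm_induct) (auto; blast)+

lemma dec_weight: "(\<psi>, \<Psi>) \<in> dec \<Phi> \<Longrightarrow> \<Psi> = \<Phi> \<or> weight \<Psi> < weight \<Phi>"
proof (induction \<Phi> arbitrary: \<psi> \<Psi> rule: pfm_induct)
  case (POr \<Phi>1 \<Phi>2)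
  then consider "\<Psi> = \<Phi>1 \<or> weight \<Psi> < weight \<Phi>1" | "\<Psi> = \<Phi>2 \<or> weight \<Psi> < weight \<Phi>2"
    | \<Psi>1 \<Psi>2 where "\<Psi> = POr \<Psi>1 \<Psi>2" "\<Psi>1 = \<Phi>1 \<or> weight \<Psi>1 < weight \<Phi>1"
        "\<Psi>2 = \<Phi>2 \<or> weight \<Psi>2 < weight \<Phi>2"
    by auto
  then show ?case
    using weight_pos[of \<Phi>1] weight_pos[of \<Phi>2] by cases auto
next
  case (PAnd \<Phi>1 \<Phi>2)
  then obtain \<Psi>1 \<Psi>2 where "\<Psi> = PAnd \<Psi>1 \<Psi>2" "\<Psi>1 = \<Phi>1 \<or> weight \<Psi>1 < weight \<Phi>1"
      "\<Psi>2 = \<Phi>2 \<or> weight \<Psi>2 < weight \<Phi>2"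
    by auto
  then show ?case by auto
qed auto

text \<open>Box and until obey their fixed-point unfoldings, and each pair in \<open>dec\<close> is
  one sufficient way to satisfy the unfolded formula; \<open>PState Top\<close> means that no
  obligation is left.\<close>

lemma psat_dec_step:
  assumes "(\<psi>, \<Psi>) \<in> dec \<Phi>" "sat M (\<pi> 0) \<psi>" "psat M (\<lambda>n. \<pi> (Suc n)) \<Psi>"
  shows "psat M \<pi> \<Phi>"
  using assms
proof (induction \<Phi> arbitrary: \<psi> \<Psi> rule: pfm_induct)
  case (PBox \<phi>)
  then have "sat M (\<pi> i) \<phi>" for i
    by (cases i) auto
  then show ?case by simp
next
  case (PUntil \<phi>1 \<phi>2)
  consider "sat M (\<pi> 0) \<phi>1" "psat M (\<lambda>n. \<pi> (Suc n)) (PUntil \<phi>1 \<phi>2)" | "sat M (\<pi> 0) \<phi>2"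
    using PUntil.prems by auto
  then show ?case
  proof cases
    case 1
    then obtain i where "sat M (\<pi> (Suc i)) \<phi>2" "\<forall>j<i. sat M (\<pi> (Suc j)) \<phi>1"
      by auto
    moreover from this 1 have "\<forall>j<Suc i. sat M (\<pi> j) \<phi>1"
      using less_Suc_eq_0_disj by auto
    ultimately show ?thesis by auto
  qed auto
next
  case (POr \<Phi>1 \<Phi>2)
  then show ?case by (auto; blast)
qed auto

text \<open>A first component is built by conjunction from elements of
  \<open>state_parts \<Phi>\<close> and \<open>Top\<close>. The conjuncts lie in \<open>H\<close> by
  the closure assumption, and \<open>Top\<close> is true everywhere.\<close>

lemma dec_sat:
  assumes "(\<psi>, \<Psi>) \<in> dec \<Phi>" "\<psi> \<in> H"
    and "\<And>\<phi> \<psi>. And \<phi> \<psi> \<in> H \<Longrightarrow> \<phi> \<in> H \<and> \<psi> \<in> H"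
    and "\<And>\<phi>. \<phi> \<in> state_parts \<Phi> \<Longrightarrow> \<phi> \<in> H \<Longrightarrow> sat M s \<phi>"
  shows "sat M s \<psi>"
  using assms(1,2,4)
proof (induction \<Phi> arbitrary: \<psi> \<Psi> rule: pfm_induct)
  case (POr \<Phi>1 \<Phi>2)
  then show ?case by (auto dest!: assms(3))
next
  case (PAnd \<Phi>1 \<Phi>2)
  then show ?case by (auto dest!: assms(3))
qed auto

text \<open>Repeating one formula forever rules out \<open>PNext\<close> and forces a state formula
  to be \<open>Top\<close>. An until keeps its left argument in all labels, while
  \<open>Real\<close> supplies the right one at \<open>k\<close>. In conjunctions and disjunctions
  both parts repeat too, and for a disjunction \<open>Real\<close> tells which one to prove.\<close>

lemma psat_of_fixed_decomposition:
  assumes "\<And>i. \<exists>\<psi>. (\<psi>, \<Phi>) \<in> dec \<Phi> \<and> \<psi> \<in> H (\<pi> i)"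
    and "Real \<Phi> (H (\<pi> k))"
    and "\<And>s \<phi> \<psi>. And \<phi> \<psi> \<in> H s \<Longrightarrow> \<phi> \<in> H s \<and> \<psi> \<in> H s"
    and "\<And>s \<phi>. \<phi> \<in> state_parts \<Phi> \<Longrightarrow> \<phi> \<in> H s \<Longrightarrow> sat M s \<phi>"
  shows "psat M \<pi> \<Phi>"
  using assms(1,2,4)
proof (induction \<Phi> rule: pfm_induct)
  case (PUntil \<phi>1 \<phi>2)
  then have "\<phi>1 \<in> H (\<pi> i)" for i by auto
  then show ?case using PUntil.prems by auto
next
  case (POr \<Phi>1 \<Phi>2)
  have *: "\<exists>\<psi>1 \<psi>2. (\<psi>1, \<Phi>1) \<in> dec \<Phi>1 \<and> (\<psi>2, \<Phi>2) \<in> dec \<Phi>2 \<and> \<psi>1 \<in> H (\<pi> i) \<and> \<psi>2 \<in> H (\<pi> i)" for i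
  proof -
    obtain \<psi> where \<psi>: "(\<psi>, POr \<Phi>1 \<Phi>2) \<in> dec (POr \<Phi>1 \<Phi>2)" "\<psi> \<in> H (\<pi> i)"
      using POr.prems(1) by blast
    \<comment> \<open>A pair inherited from one disjunct leads to that disjunct or to something
      lighter, never back to the whole disjunction; so the pair combines pairs of both
      disjuncts.\<close>
    have "(\<psi>, POr \<Phi>1 \<Phi>2) \<notin> dec \<Phi>1" "(\<psi>, POr \<Phi>1 \<Phi>2) \<notin> dec \<Phi>2"
      using dec_weight[of \<psi> "POr \<Phi>1 \<Phi>2"] by fastforce+
    with \<psi> show ?thesis by (auto dest!: assms(3))
  qed
  from POr.prems(2) consider "Real \<Phi>1 (H (\<pi> k))" | "Real \<Phi>2 (H (\<pi> k))" by auto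
  then show ?case
  proof cases
    case 1
    have "psat M \<pi> \<Phi>1"
      by (rule POr.IH(1)) (use * 1 POr.prems(3) in fastforce)+
    then show ?thesis by simp
  next
    case 2
    have "psat M \<pi> \<Phi>2"
      by (rule POr.IH(2)) (use * 2 POr.prems(3) in fastforce)+
    then show ?thesis by simp
  qed
next
  case (PAnd \<Phi>1 \<Phi>2)
  have *: "\<exists>\<psi>1 \<psi>2. (\<psi>1, \<Phi>1) \<in> dec \<Phi>1 \<and> (\<psi>2, \<Phi>2) \<in> dec \<Phi>2 \<and> \<psi>1 \<in> H (\<pi> i) \<and> \<psi>2 \<in> H (\<pi> i)" for i
    using PAnd.prems(1)[of i] by (auto dest!: assms(3))
  have "psat M \<pi> \<Phi>1"
    by (rule PAnd.IH(1)) (use * PAnd.prems(2,3) in fastforce)+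
  moreover have "psat M \<pi> \<Phi>2"
    by (rule PAnd.IH(2)) (use * PAnd.prems(2,3) in fastforce)+
  ultimately show ?case by simp
qed auto

lemma eventually_constant_of_weight:
  assumes "\<And>i. \<Phi> (Suc i) = \<Phi> i \<or> weight (\<Phi> (Suc i)) < weight (\<Phi> i)"
  obtains N where "\<And>i. N \<le> i \<Longrightarrow> \<Phi> i = \<Phi> N"
proof -
  \<comment> \<open>From a position of least weight on, no step can lower the weight, so every step
    keeps the formula.\<close>
  obtain N where N: "\<And>i. weight (\<Phi> N) \<le> weight (\<Phi> i)"
    using ex_has_least_nat[of "\<lambda>_. True" _ "\<lambda>i. weight (\<Phi> i)"] by blast
  have "\<Phi> i = \<Phi> N" if "N \<le> i" for i
    using that
  proof (induction i rule: dec_induct)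
    case (step i)
    then show ?case using assms[of i] N[of "Suc i"] by auto
  qed simp
  then show ?thesis using that by blast
qed

section \<open>Strategies as choices of outcome sets\<close>

text \<open>An abstraction of strategies and co-strategies alike: at each history the player picks
  one set of possible successors. This allows one argument to cover both quantifiers.\<close>

definition enforceable :: "('s \<Rightarrow> 's set set) \<Rightarrow> 's \<Rightarrow> ((nat \<Rightarrow> 's) \<Rightarrow> bool) \<Rightarrow> bool" where
  "enforceable moves s P \<longleftrightarrow> (\<exists>g. (\<forall>h. g h \<in> moves (last h)) \<and>
     (\<forall>\<pi>. \<pi> 0 = s \<longrightarrow> (\<forall>i. \<pi> (Suc i) \<in> g (prefix \<pi> i)) \<longrightarrow> P \<pi>))"

lemma last_prefix [simp]: "last (prefix \<pi> i) = \<pi> i"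
  by (simp add: prefix_def)

lemma prefix_0 [simp]: "prefix \<pi> 0 = [\<pi> 0]"
  by (simp add: prefix_def)

lemma prefix_Suc: "prefix \<pi> (Suc i) = prefix \<pi> i @ [\<pi> (Suc i)]"
  by (simp add: prefix_def)

lemma enforceable_next:
  assumes "\<And>s. moves s \<noteq> {}" "X \<in> moves s" "\<And>\<pi>. \<pi> 1 \<in> X \<Longrightarrow> P \<pi>"
  shows "enforceable moves s P"
  unfolding enforceable_def
proof (intro exI conjI allI impI)
  \<comment> \<open>Only the choice at the initial history matters; all other moves are
    arbitrary.\<close>
  let ?g = "\<lambda>h. if h = [s] then X else (SOME Y. Y \<in> moves (last h))"
  show "?g h \<in> moves (last h)" for h
    using assms(1,2) by (auto simp: some_in_eq)
  fix \<pi> :: "nat \<Rightarrow> 'a"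
  assume "\<pi> 0 = s" "\<forall>i. \<pi> (Suc i) \<in> ?g (prefix \<pi> i)"
  then have "\<pi> 1 \<in> X" by (metis One_nat_def prefix_0)
  then show "P \<pi>" by (rule assms(3))
qed

text \<open>Perfect recall subsumes internal memory: the memory content is recomputed from the
  history by folding \<open>upd\<close> over it.\<close>

lemma enforceable_memory:
  fixes m0 :: 'm and moves :: "'s \<Rightarrow> 's set set"
  assumes "\<And>m s. mv m s \<in> moves s"
    and "\<And>\<pi> m. \<lbrakk>\<pi> 0 = s; m 0 = m0; \<And>i. m (Suc i) = upd (m i) (\<pi> (Suc i));
            \<And>i. \<pi> (Suc i) \<in> mv (m i) (\<pi> i)\<rbrakk> \<Longrightarrow> P \<pi>"
  shows "enforceable moves s P"
  unfolding enforceable_def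
proof (intro exI conjI allI impI)
  \<comment> \<open>The initial state is dropped because \<open>m0\<close> is already the memory
    content at that state.\<close>
  let ?mem = "\<lambda>h. foldl upd m0 (tl h)"
  show "mv (?mem h) (last h) \<in> moves (last h)" for h
    by (rule assms(1))
  fix \<pi> :: "nat \<Rightarrow> 's"
  assume *: "\<pi> 0 = s" "\<forall>i. \<pi> (Suc i) \<in> mv (?mem (prefix \<pi> i)) (last (prefix \<pi> i))"
  have "prefix \<pi> i \<noteq> []" for i by (simp add: prefix_def)
  with * show "P \<pi>"
    by (intro assms(2)[where m = "\<lambda>i. ?mem (prefix \<pi> i)"]) (simp_all add: prefix_Suc)
qed

section \<open>Following witness trees\<close>

text \<open>Collects what the Hintikka conditions and the nonempty action sets give for a single
  quantifier \<open>Q\<close>, to be instantiated with \<open>Strat A\<close> and with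
  \<open>CoStrat A\<close>.\<close>

locale eventuality_game =
  fixes Q :: "('ag, 'p) pfm \<Rightarrow> ('ag, 'p) sfm"
    and moves :: "'s \<Rightarrow> 's set set"
    and H :: "'s \<Rightarrow> ('ag, 'p) sfm set"
  assumes moves_nonempty: "moves s \<noteq> {}"
    and And_closed: "And \<phi> \<psi> \<in> H s \<Longrightarrow> \<phi> \<in> H s \<and> \<psi> \<in> H s"
    and gamma: "\<lbrakk>Q \<Phi> \<in> H s; \<not> is_next \<Phi>\<rbrakk> \<Longrightarrow> \<exists>\<psi> \<Psi>. (\<psi>, \<Psi>) \<in> dec \<Phi> \<and> gamma_component Q \<psi> \<Psi> \<in> H s"
    and "next": "Q (PNext \<phi>) \<in> H s \<Longrightarrow> \<exists>X\<in>moves s. \<forall>t\<in>X. \<phi> \<in> H t"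
    and tree: "\<lbrakk>Q \<Phi> \<in> H s; \<not> is_next \<Phi>\<rbrakk> \<Longrightarrow>
      \<exists>T. witness_tree Q moves H T \<and> colour T = s \<and> carried T = \<Phi>"
    and eventuality_not_next: "potential_eventuality (Q \<Phi>) \<Longrightarrow> \<not> is_next \<Phi>"
begin

text \<open>The last argument is the memory after the move to \<open>t\<close>: \<open>None\<close>
  once no obligation is left, otherwise the next tree, which is a child or, after a realized leaf, a
  fresh witness tree at \<open>t\<close>.\<close>

fun tree_step :: "('ag, 's, 'p) wtree \<Rightarrow> 's \<Rightarrow> ('ag, 's, 'p) wtree option \<Rightarrow> bool" where
  "tree_step T t None \<longleftrightarrow> (\<exists>\<psi>. (\<psi>, PState Top) \<in> dec (carried T) \<and> \<psi> \<in> H (colour T))"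
| "tree_step T t (Some T') \<longleftrightarrow>
     (\<exists>\<psi>. (\<psi>, carried T') \<in> dec (carried T) \<and> \<psi> \<in> H (colour T)) \<and>
     witness_tree Q moves H T' \<and> colour T' = t \<and>
     (children T = [] \<and> Real (carried T) (H (colour T)) \<or> T' \<in> set (children T))"

lemma tree_step_exists:
  assumes "witness_tree Q moves H T"
  shows "\<exists>X\<in>moves (colour T). \<forall>t\<in>X. \<exists>m. tree_step T t m"
proof -
  obtain c \<Phi> ts where T: "T = WNode c \<Phi> ts" by (cases T)
  have Q: "Q \<Phi> \<in> H c" "\<not> is_next \<Phi>"
    using assms T eventuality_not_next by auto
  show ?thesis
  proof (cases "ts = []")
    case True
    then have real: "Real \<Phi> (H c)" using assms T by simp
    obtain \<psi> \<Psi> where dec: "(\<psi>, \<Psi>) \<in> dec \<Phi>" and comp: "gamma_component Q \<psi> \<Psi> \<in> H c"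
      using gamma[OF Q] by blast
    show ?thesis
    proof (cases "\<Psi> = PState Top")
      case top: True
      \<comment> \<open>No obligation remains, so any available move will do.\<close>
      then have "tree_step T t None" for t
        using dec comp T by (auto simp: gamma_component_def)
      then show ?thesis using moves_nonempty by blast
    next
      case False
      then have "\<psi> \<in> H c" "Q (PNext (Q \<Psi>)) \<in> H c"
        using comp And_closed[of \<psi> "Q (PNext (Q \<Psi>))" c] by (simp_all add: gamma_component_def)
      then obtain X where X: "X \<in> moves c" "\<forall>t\<in>X. Q \<Psi> \<in> H t"
        using "next" by blast
      have "\<exists>m. tree_step T t m" if t: "t \<in> X" for t
      proof -
        \<comment> \<open>Second components in \<open>dec\<close> never have next as main operator,
          so \<open>tree\<close> applies to \<open>Q \<Psi>\<close> at the state reached.\<close>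
        obtain T' where "witness_tree Q moves H T'" "colour T' = t" "carried T' = \<Psi>"
          using tree[of \<Psi> t] X(2) t dec_not_next[OF dec] by blast
        then have "tree_step T t (Some T')"
          using T True real dec \<open>\<psi> \<in> H c\<close> by auto
        then show ?thesis ..
      qed
      then show ?thesis using X(1) T by auto
    qed
  next
    case False
    then obtain \<psi> \<Psi> X where dec: "(\<psi>, \<Psi>) \<in> dec \<Phi>" "\<psi> \<in> H c"
      and X: "X \<in> moves c" "set (map colour ts) = X" and ts: "\<forall>t\<in>set ts. carried t = \<Psi>"
      using assms T by auto
    have "\<exists>m. tree_step T t m" if t: "t \<in> X" for t
    proof -
      obtain T' where "T' \<in> set ts" "colour T' = t"
        using X(2) t by auto
      then have "tree_step T t (Some T')"
        using assms T dec ts by auto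
      then show ?thesis ..
    qed
    then show ?thesis using X(1) T by auto
  qed
qed

lemma tree_step_psat:
  assumes "tree_step T t m" "colour T = \<pi> 0"
    and "\<And>s \<phi>. \<phi> \<in> state_parts (carried T) \<Longrightarrow> \<phi> \<in> H s \<Longrightarrow> sat M s \<phi>"
    and "case m of None \<Rightarrow> True | Some T' \<Rightarrow> psat M (\<lambda>n. \<pi> (Suc n)) (carried T')"
  shows "psat M \<pi> (carried T)"
proof -
  \<comment> \<open>For \<open>m = None\<close> the second component is \<open>PState Top\<close>,
    which holds on every play.\<close>
  obtain \<psi> \<Psi> where dec: "(\<psi>, \<Psi>) \<in> dec (carried T)" "\<psi> \<in> H (\<pi> 0)"
    and rest: "psat M (\<lambda>n. \<pi> (Suc n)) \<Psi>"
    using assms(1,2,4) by (cases m) (auto intro: that)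
  from dec And_closed assms(3) have "sat M (\<pi> 0) \<psi>"
    by (rule dec_sat)
  from psat_dec_step[OF dec(1) this rest] show ?thesis .
qed

text \<open>Descending to a child shrinks the tree, so this cannot go on forever; a step that does
  not descend is possible only at a leaf where \<open>Real\<close> holds.\<close>

lemma tree_run_reaches_leaf:
  assumes "\<And>i. tree_step (T i) (\<pi> (Suc i)) (Some (T (Suc i)))"
  shows "\<exists>j\<ge>i. Real (carried (T j)) (H (colour (T j)))"
proof (induction "size (T i)" arbitrary: i rule: less_induct)
  case less
  show ?case
  proof (cases "T (Suc i) \<in> set (children (T i))")
    case True
    then have "size (T (Suc i)) < size (T i)"
      by (cases "T i") (auto simp: less_Suc_eq_le intro!: trans_le_add2 size_list_estimation')
    then show ?thesis using less Suc_leD by blast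
  next
    case False
    then show ?thesis using assms[of i] by auto
  qed
qed

lemma infinite_tree_run_psat:
  assumes step: "\<And>i. tree_step (T i) (\<pi> (Suc i)) (Some (T (Suc i)))"
    and colour: "\<And>i. colour (T i) = \<pi> i"
    and sound: "\<And>i s \<phi>. \<phi> \<in> state_parts (carried (T i)) \<Longrightarrow> \<phi> \<in> H s \<Longrightarrow> sat M s \<phi>"
  shows "psat M \<pi> (carried (T 0))"
proof -
  have dec: "\<exists>\<psi>. (\<psi>, carried (T (Suc i))) \<in> dec (carried (T i)) \<and> \<psi> \<in> H (\<pi> i)" for i
    using step[of i] colour[of i] by auto
  then obtain N where N: "\<And>i. N \<le> i \<Longrightarrow> carried (T i) = carried (T N)"
    using eventually_constant_of_weight[of "\<lambda>i. carried (T i)"] dec_weight by metis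
  obtain j where j: "N \<le> j" "Real (carried (T N)) (H (\<pi> j))"
    using tree_run_reaches_leaf[of T \<pi> N] step colour N by metis
  have "psat M (\<lambda>n. \<pi> (N + n)) (carried (T N))"
  proof (rule psat_of_fixed_decomposition[where H = H])
    show "\<exists>\<psi>. (\<psi>, carried (T N)) \<in> dec (carried (T N)) \<and> \<psi> \<in> H (\<pi> (N + i))" for i
      using dec[of "N + i"] N[of "N + i"] N[of "Suc (N + i)"] by simp
    show "Real (carried (T N)) (H (\<pi> (N + (j - N))))"
      using j by simp
  qed (fact And_closed, fact sound)
  \<comment> \<open>Truth on the suffix from \<open>N\<close> is carried back one position at a time
    to 0.\<close>
  with le0[of N] have "psat M (\<lambda>n. \<pi> (0 + n)) (carried (T 0))"
  proof (induction rule: inc_induct)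
    case (step i)
    show ?case
    proof (rule tree_step_psat[OF assms(1)])
      show "case Some (T (Suc i)) of None \<Rightarrow> True
          | Some T' \<Rightarrow> psat M (\<lambda>n. \<pi> (i + Suc n)) (carried T')"
        using step.IH step.prems by simp
    qed (simp add: colour, fact sound)
  qed
  then show ?thesis by simp
qed

lemma tree_run_psat:
  assumes step: "\<And>i T. m i = Some T \<Longrightarrow> colour T = \<pi> i \<and> tree_step T (\<pi> (Suc i)) (m (Suc i))"
    and "m 0 = Some T"
    and sound: "\<And>s \<phi>. \<phi> \<in> state_parts (carried T) \<Longrightarrow> \<phi> \<in> H s \<Longrightarrow> sat M s \<phi>"
  shows "psat M \<pi> (carried T)"
proof (cases "\<exists>k. m k = None")
  case True
  then obtain k where "m k = None" by blast
  then show ?thesis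
    using assms
  \<comment> \<open>The base case contradicts \<open>m 0 = Some T\<close>; the induction hypothesis
    is applied to the run shifted by one.\<close>
  proof (induction k arbitrary: m \<pi> T)
    case (Suc k)
    have T: "colour T = \<pi> 0" "tree_step T (\<pi> 1) (m 1)"
      using Suc.prems(2)[OF Suc.prems(3)] by auto
    have "case m 1 of None \<Rightarrow> True | Some T' \<Rightarrow> psat M (\<lambda>n. \<pi> (Suc n)) (carried T')"
    proof (cases "m 1")
      case (Some T')
      then obtain \<psi> where "(\<psi>, carried T') \<in> dec (carried T)"
        using T by auto
      \<comment> \<open>Soundness passes to the next tree because the only possible new state part
        is \<open>Top\<close>.\<close>
      then have "state_parts (carried T') \<subseteq> insert Top (state_parts (carried T))"
        by (rule dec_state_parts)
      then have "psat M (\<lambda>n. \<pi> (Suc n)) (carried T')"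
        using Suc.prems Some by (intro Suc.IH[of "\<lambda>n. m (Suc n)"]) auto
      then show ?thesis using Some by simp
    qed simp
    then show ?case
      using tree_step_psat T Suc.prems(4) by blast
  qed simp
next
  case False
  define T' where "T' i = the (m i)" for i
  have m: "m i = Some (T' i)" for i
    using False by (auto simp: T'_def)
  have T': "colour (T' i) = \<pi> i" "tree_step (T' i) (\<pi> (Suc i)) (Some (T' (Suc i)))" for i
    using step[OF m] m by metis+
  have "state_parts (carried (T' i)) \<subseteq> insert Top (state_parts (carried T))" for i
  proof (induction i)
    case 0
    then show ?case using m assms(2) by auto
  next
    case (Suc i)
    obtain \<psi> where "(\<psi>, carried (T' (Suc i))) \<in> dec (carried (T' i))"
      using T'(2)[of i] by auto
    from dec_state_parts[OF this] Suc show ?case by blast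
  qed
  then have sound': "sat M s \<phi>" if "\<phi> \<in> state_parts (carried (T' i))" "\<phi> \<in> H s" for i s \<phi>
    using that sound[of \<phi> s] sat_Top[of M s] by blast
  have "psat M \<pi> (carried (T' 0))"
    by (rule infinite_tree_run_psat[of T' \<pi>, OF T'(2,1) sound'])
  then show ?thesis using m assms(2) by simp
qed

text \<open>Next formulae are not potential eventualities and come without a tree, so one move given
  by \<open>next\<close> settles them; for all others a witness tree serves as memory.\<close>

lemma enforceable_psat:
  assumes "Q \<Phi> \<in> H s"
    and sound: "\<And>s \<phi>. \<phi> \<in> state_parts \<Phi> \<Longrightarrow> \<phi> \<in> H s \<Longrightarrow> sat M s \<phi>"
  shows "enforceable moves s (\<lambda>\<pi>. psat M \<pi> \<Phi>)"
proof (cases "is_next \<Phi>")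
  case True
  then obtain \<phi> where \<Phi>: "\<Phi> = PNext \<phi>" by (cases \<Phi>) auto
  then obtain X where "X \<in> moves s" "\<forall>t\<in>X. \<phi> \<in> H t"
    using "next" assms(1) by blast
  then show ?thesis
    using sound \<Phi> by (intro enforceable_next[where X = X]) (auto simp: moves_nonempty)
next
  case False
  then obtain T where T: "witness_tree Q moves H T" "colour T = s" "carried T = \<Phi>"
    using tree assms(1) by blast
  obtain X where X: "\<And>T. witness_tree Q moves H T \<Longrightarrow>
      X T \<in> moves (colour T) \<and> (\<forall>t\<in>X T. \<exists>m. tree_step T t m)"
    using tree_step_exists by metis
  define valid where "valid m c \<longleftrightarrow> (\<exists>T. m = Some T \<and> witness_tree Q moves H T \<and> colour T = c)" for m c
  \<comment> \<open>The default keeps \<open>mv\<close> a legal move for every memory content,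
    including \<open>None\<close> after the obligation is discharged.\<close>
  define mv where "mv m c = (if valid m c then X (the m) else (SOME Y. Y \<in> moves c))" for m c
  define upd where
    "upd m t = (case m of None \<Rightarrow> None | Some T \<Rightarrow> (SOME m'. tree_step T t m'))" for m t
  show ?thesis
  proof (rule enforceable_memory[where mv = mv and upd = upd and ?m0.0 = "Some T"])
    show "mv m c \<in> moves c" for m c
      using X moves_nonempty by (auto simp: mv_def valid_def some_in_eq)
  next
    fix \<pi> m
    assume \<pi>: "\<pi> 0 = s" "m 0 = Some T" "\<And>i. m (Suc i) = upd (m i) (\<pi> (Suc i))"
      "\<And>i. \<pi> (Suc i) \<in> mv (m i) (\<pi> i)"
    have step: "tree_step T' (\<pi> (Suc i)) (m (Suc i))" if "m i = Some T'" "valid (m i) (\<pi> i)" for i T'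
    proof -
      have "\<exists>m'. tree_step T' (\<pi> (Suc i)) m'"
        using X[of T'] \<pi>(4)[of i] that by (auto simp: mv_def valid_def)
      then show ?thesis
        using \<pi>(3)[of i] that by (simp add: upd_def someI_ex)
    qed
    \<comment> \<open>Invariant: until it becomes \<open>None\<close>, the memory is a witness tree
      rooted at the current state, so the move played is the one given by \<open>X\<close>.\<close>
    have "m i = None \<or> valid (m i) (\<pi> i)" for i
    proof (induction i)
      case 0
      then show ?case using \<pi> T by (simp add: valid_def)
    next
      case (Suc i)
      then show ?case
      proof (cases "m i")
        case None
        then show ?thesis using \<pi>(3) by (simp add: upd_def)
      next
        case (Some T')
        then show ?thesis
          using step[of i T'] Suc by (cases "m (Suc i)") (auto simp: valid_def)
      qed
    qed
    then have "colour T' = \<pi> i \<and> tree_step T' (\<pi> (Suc i)) (m (Suc i))" if "m i = Some T'" for i T'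
      using step[OF that] that unfolding valid_def by (metis option.distinct(1) option.inject)
    then show "psat M \<pi> \<Phi>"
      using tree_run_psat[of m \<pi> T M] \<pi>(2) T(3) sound by blast
  qed
qed

end

section \<open>From outcome sets to strategies and co-strategies\<close>

lemma actions_nonempty: "cgs S \<Longrightarrow> actions S A s \<noteq> {}"
  by (simp add: actions_def cgs_def PiE_eq_empty_iff)

lemma co_actions_nonempty: "cgs S \<Longrightarrow> co_actions S A s \<noteq> {}"
  using actions_nonempty by (fastforce simp: co_actions_def PiE_eq_empty_iff)

lemma combine_in_actions:
  "\<lbrakk>\<sigma> \<in> actions S A s; \<tau> \<in> actions S (- A) s\<rbrakk> \<Longrightarrow> combine A \<sigma> \<tau> \<in> actions S UNIV s"
  by (auto simp: actions_def combine_def PiE_iff)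

text \<open>Histories are prefixes of infinite plays, so a finite path has to be prolonged; nonempty
  action sets make this possible.\<close>

lemma history_prefix:
  assumes "cgs S" and "\<And>j. j < n \<Longrightarrow> \<exists>\<sigma>\<in>actions S UNIV (\<pi> j). \<pi> (Suc j) = out S (\<pi> j) \<sigma>"
  shows "history S (prefix \<pi> n)"
proof -
  define nxt where "nxt s = out S s (SOME \<sigma>. \<sigma> \<in> actions S UNIV s)" for s
  have nxt: "\<exists>\<sigma>\<in>actions S UNIV s. nxt s = out S s \<sigma>" for s
    unfolding nxt_def using actions_nonempty[OF assms(1)] some_in_eq by blast
  define \<pi>' where "\<pi>' j = (if j \<le> n then \<pi> j else (nxt ^^ (j - n)) (\<pi> n))" for j
  have "\<exists>\<sigma>\<in>actions S UNIV (\<pi>' i). \<pi>' (Suc i) = out S (\<pi>' i) \<sigma>" for i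
  proof (cases "i < n")
    case True
    then show ?thesis using assms(2) by (simp add: \<pi>'_def)
  next
    case False
    then have "\<pi>' (Suc i) = nxt (\<pi>' i)"
      by (auto simp: \<pi>'_def Suc_diff_le le_less_Suc_eq not_less)
    then show ?thesis using nxt by simp
  qed
  moreover have "prefix \<pi> n = prefix \<pi>' n"
    by (auto simp: prefix_def \<pi>'_def)
  ultimately show ?thesis unfolding history_def play_def by blast
qed

text \<open>\<open>co_consistent\<close> does not mention availability, and strategies are
  constrained on histories only. Availability and being a history are therefore established
  together: legal actions at all earlier positions make the current prefix a history, which makes
  the next action legal.\<close>

lemma co_consistent_actions:
  assumes "cgs S" "co_strategy S A G" "strategy S A F"
    and \<pi>: "\<And>i. \<pi> (Suc i) = out S (\<pi> i) (combine A (F (prefix \<pi> i)) (G (prefix \<pi> i) F))"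
  shows "F (prefix \<pi> i) \<in> actions S A (\<pi> i)"
proof -
  have "history S (prefix \<pi> i)"
  proof (induction i rule: less_induct)
    case (less i)
    have "\<exists>\<sigma>\<in>actions S UNIV (\<pi> j). \<pi> (Suc j) = out S (\<pi> j) \<sigma>" if "j < i" for j
    proof -
      have "F (prefix \<pi> j) \<in> actions S A (\<pi> j)" "G (prefix \<pi> j) F \<in> actions S (- A) (\<pi> j)"
        using less[OF that] assms(2,3) unfolding strategy_def co_strategy_def by fastforce+
      then have "combine A (F (prefix \<pi> j)) (G (prefix \<pi> j) F) \<in> actions S UNIV (\<pi> j)"
        by (rule combine_in_actions)
      with \<pi>[of j] show ?thesis by (intro bexI)
    qed
    then show ?case by (rule history_prefix[OF assms(1)])
  qed
  then show ?thesis using assms(3) unfolding strategy_def by fastforce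
qed

lemma sat_Strat_of_enforceable:
  assumes "enforceable (strat_moves M A) s (\<lambda>\<pi>. psat M \<pi> \<Phi>)"
  shows "sat M s (Strat A \<Phi>)"
proof -
  obtain g where g: "\<And>h. g h \<in> strat_moves M A (last h)"
    "\<And>\<pi>. \<pi> 0 = s \<Longrightarrow> \<forall>i. \<pi> (Suc i) \<in> g (prefix \<pi> i) \<Longrightarrow> psat M \<pi> \<Phi>"
    using assms unfolding enforceable_def by blast
  from g(1) have "\<exists>\<sigma>. \<sigma> \<in> actions M A (last h) \<and> g h = Out M A (last h) \<sigma>" for h
    unfolding strat_moves_def by blast
  then obtain F where "\<And>h. F h \<in> actions M A (last h) \<and> g h = Out M A (last h) (F h)"
    by metis
  then show ?thesis
    using g(2) by (auto simp: strategy_def consistent_def intro!: exI[of _ F])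
qed

lemma sat_CoStrat_of_enforceable:
  assumes "cgs M" and "enforceable (co_strat_moves M A) s (\<lambda>\<pi>. psat M \<pi> \<Phi>)"
  shows "sat M s (CoStrat A \<Phi>)"
proof -
  obtain g where g: "\<And>h. g h \<in> co_strat_moves M A (last h)"
    "\<And>\<pi>. \<pi> 0 = s \<Longrightarrow> \<forall>i. \<pi> (Suc i) \<in> g (prefix \<pi> i) \<Longrightarrow> psat M \<pi> \<Phi>"
    using assms(2) unfolding enforceable_def by blast
  from g(1) have "\<exists>\<sigma>. \<sigma> \<in> co_actions M A (last h) \<and> g h = co_Out M A (last h) \<sigma>" for h
    unfolding co_strat_moves_def by blast
  then obtain C where C: "\<And>h. C h \<in> co_actions M A (last h) \<and> g h = co_Out M A (last h) (C h)"
    by metis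
  \<comment> \<open>The co-strategy uses only the action that \<open>F\<close> prescribes at the
    current history, so one co-action per history suffices.\<close>
  let ?G = "\<lambda>h F. C h (F h)"
  have G: "co_strategy M A ?G"
    using C unfolding co_strategy_def strategy_def co_actions_def by (metis PiE_mem)
  have "psat M \<pi> \<Phi>" if con: "co_consistent M A s ?G \<pi>" for \<pi>
  proof -
    obtain F where F: "\<pi> 0 = s" "strategy M A F"
      "\<And>i. \<pi> (Suc i) = out M (\<pi> i) (combine A (F (prefix \<pi> i)) (?G (prefix \<pi> i) F))"
      using con unfolding co_consistent_def by blast
    \<comment> \<open>Membership in \<open>co_Out\<close> asks for an available action of
      \<open>A\<close>, which \<open>co_consistent_actions\<close> provides.\<close>
    have "\<pi> (Suc i) \<in> g (prefix \<pi> i)" for i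
      using co_consistent_actions[OF assms(1) G F(2), of \<pi> i] F(3) C[of "prefix \<pi> i"]
      by (auto simp: co_Out_def)
    then show ?thesis using g(2) F(1) by blast
  qed
  with G show ?thesis by auto
qed

lemma model_of_simps:
  "cgs (model_of S) = cgs S"
  "strat_moves (model_of S) = strat_moves S"
  "co_strat_moves (model_of S) = co_strat_moves S"
  by (simp_all add: model_of_def cgs_def fun_eq_iff strat_moves_def co_strat_moves_def actions_def
      co_actions_def Out_def co_Out_def)

section \<open>Truth of the labels\<close>

context
  fixes S :: "('ag, 's, 'act, 'p) cghs"
  assumes hintikka: "hintikka_structure S"
begin

lemma hintikka_cgs: "cgs S"
  using hintikka by (simp add: hintikka_structure_def)

lemma hintikka_literal: "NegAtom p \<in> Hint S s \<Longrightarrow> Atom p \<notin> Hint S s"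
  using hintikka[unfolded hintikka_structure_def, THEN conjunct2, THEN spec[of _ s]] by meson

lemma hintikka_Or: "Or \<phi> \<psi> \<in> Hint S s \<Longrightarrow> \<phi> \<in> Hint S s \<or> \<psi> \<in> Hint S s"
  using hintikka[unfolded hintikka_structure_def, THEN conjunct2, THEN spec[of _ s]] by meson

lemma hintikka_And: "And \<phi> \<psi> \<in> Hint S s \<Longrightarrow> \<phi> \<in> Hint S s \<and> \<psi> \<in> Hint S s"
proof -
  assume "And \<phi> \<psi> \<in> Hint S s"
  then have "alpha_components (And \<phi> \<psi>) \<subseteq> Hint S s"
    using hintikka[unfolded hintikka_structure_def, THEN conjunct2, THEN spec[of _ s]] by meson
  then show ?thesis by simp
qed

lemma hintikka_gamma:
  "\<lbrakk>\<xi> \<in> Hint S s; potential_eventuality \<xi>\<rbrakk> \<Longrightarrow> gamma_components \<xi> \<inter> Hint S s \<noteq> {}"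
  using hintikka[unfolded hintikka_structure_def, THEN conjunct2, THEN spec[of _ s]] by meson

lemma hintikka_Strat_next:
  "Strat A (PNext \<phi>) \<in> Hint S s \<Longrightarrow> \<exists>\<sigma>A\<in>actions S A s. \<forall>t\<in>Out S A s \<sigma>A. \<phi> \<in> Hint S t"
  using hintikka[unfolded hintikka_structure_def, THEN conjunct2, THEN spec[of _ s]] by meson

lemma hintikka_CoStrat_next:
  "CoStrat A (PNext \<phi>) \<in> Hint S s \<Longrightarrow> \<exists>\<sigma>c\<in>co_actions S A s. \<forall>t\<in>co_Out S A s \<sigma>c. \<phi> \<in> Hint S t"
  using hintikka[unfolded hintikka_structure_def, THEN conjunct2, THEN spec[of _ s]] by meson

lemma hintikka_witness_tree:
  "\<lbrakk>\<xi> \<in> Hint S s; potential_eventuality \<xi>\<rbrakk> \<Longrightarrow> has_witness_tree S s \<xi>"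
  using hintikka[unfolded hintikka_structure_def, THEN conjunct2, THEN spec[of _ s]] by meson

lemma eventuality_game_Strat: "eventuality_game (Strat A) (strat_moves S A) (Hint S)"
proof
  show "strat_moves S A s \<noteq> {}" for s
    using actions_nonempty[OF hintikka_cgs, of A s] by (simp add: strat_moves_def)
next
  fix \<Phi> s
  assume "Strat A \<Phi> \<in> Hint S s" "\<not> is_next \<Phi>"
  then show "\<exists>\<psi> \<Psi>. (\<psi>, \<Psi>) \<in> dec \<Phi> \<and> gamma_component (Strat A) \<psi> \<Psi> \<in> Hint S s"
    using hintikka_gamma[of "Strat A \<Phi>" s] by auto
next
  fix \<Phi> s
  assume "Strat A \<Phi> \<in> Hint S s" "\<not> is_next \<Phi>"
  then show "\<exists>T. witness_tree (Strat A) (strat_moves S A) (Hint S) T \<and> colour T = s \<and> carried T = \<Phi>"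
    using hintikka_witness_tree[of "Strat A \<Phi>" s] by simp
next
  fix \<phi> s
  assume "Strat A (PNext \<phi>) \<in> Hint S s"
  then show "\<exists>X\<in>strat_moves S A s. \<forall>t\<in>X. \<phi> \<in> Hint S t"
    using hintikka_Strat_next[of A \<phi> s] by (auto simp: strat_moves_def)
qed (rule hintikka_And, assumption, simp)

lemma eventuality_game_CoStrat: "eventuality_game (CoStrat A) (co_strat_moves S A) (Hint S)"
proof
  show "co_strat_moves S A s \<noteq> {}" for s
    using co_actions_nonempty[OF hintikka_cgs, of A s] by (simp add: co_strat_moves_def)
next
  fix \<Phi> s
  assume "CoStrat A \<Phi> \<in> Hint S s" "\<not> is_next \<Phi>"
  then show "\<exists>\<psi> \<Psi>. (\<psi>, \<Psi>) \<in> dec \<Phi> \<and> gamma_component (CoStrat A) \<psi> \<Psi> \<in> Hint S s"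
    using hintikka_gamma[of "CoStrat A \<Phi>" s] by auto
next
  fix \<Phi> s
  assume "CoStrat A \<Phi> \<in> Hint S s" "\<not> is_next \<Phi>"
  then show "\<exists>T. witness_tree (CoStrat A) (co_strat_moves S A) (Hint S) T \<and> colour T = s \<and> carried T = \<Phi>"
    using hintikka_witness_tree[of "CoStrat A \<Phi>" s] by simp
next
  fix \<phi> s
  assume "CoStrat A (PNext \<phi>) \<in> Hint S s"
  then show "\<exists>X\<in>co_strat_moves S A s. \<forall>t\<in>X. \<phi> \<in> Hint S t"
    using hintikka_CoStrat_next[of A \<phi> s] by (auto simp: co_strat_moves_def)
qed (rule hintikka_And, assumption, simp)

text \<open>The clause for path formulae speaks about all states at once, since a play may visit any
  of them; it is exactly the soundness premise of \<open>enforceable_psat\<close>.\<close>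

lemma truth_lemma:
  shows "\<phi> \<in> Hint S s \<Longrightarrow> sat (model_of S) s \<phi>"
    and "\<forall>\<phi>\<in>state_parts \<Phi>. \<forall>t. \<phi> \<in> Hint S t \<longrightarrow> sat (model_of S) t \<phi>"
proof (induction \<phi> and \<Phi> arbitrary: s)
  case (NegAtom p)
  with hintikka_literal show ?case by (simp add: model_of_def)
next
  case (Or \<phi> \<psi>)
  with hintikka_Or[of \<phi> \<psi> s] show ?case by auto
next
  case (Strat A \<Phi>)
  have "enforceable (strat_moves S A) s (\<lambda>\<pi>. psat (model_of S) \<pi> \<Phi>)"
    using Strat.prems
    by (rule eventuality_game.enforceable_psat[OF eventuality_game_Strat]) (use Strat.IH in blast)
  then show ?case
    by (intro sat_Strat_of_enforceable) (simp add: model_of_simps)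
next
  case (CoStrat A \<Phi>)
  have "enforceable (co_strat_moves S A) s (\<lambda>\<pi>. psat (model_of S) \<pi> \<Phi>)"
    using CoStrat.prems
    by (rule eventuality_game.enforceable_psat[OF eventuality_game_CoStrat]) (use CoStrat.IH in blast)
  then show ?case
    by (intro sat_CoStrat_of_enforceable) (simp_all add: model_of_simps hintikka_cgs)
next
  case (And \<phi> \<psi>)
  with hintikka_And[of \<phi> \<psi> s] show ?case by simp
next
  case (Atom p)
  then show ?case by (simp add: model_of_def)
qed auto

end

theorem theorem3:
  fixes S :: "('ag, 's, 'act, 'p) cghs" and \<eta> :: "('ag, 'p) sfm"
  assumes "hintikka_structure_for S \<eta>"
  shows "(\<forall>s \<phi>. \<phi> \<in> Hint S s \<longrightarrow> sat (model_of S) s \<phi>) \<and> (\<exists>s. sat (model_of S) s \<eta>)"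
proof -
  have hintikka: "hintikka_structure S" and "\<exists>s. \<eta> \<in> Hint S s"
    using assms by (simp_all add: hintikka_structure_for_def)
  with truth_lemma(1)[OF hintikka] show ?thesis by blast
qed

end
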